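(* Let $G$ be a Lie group acting (left action) on the dependent variables $\mathbf{u}$, and let $\mathsf{L}(n,\mathbf{u}_0,\dots,\mathbf{u}_J)$ be a Lagrangian such that for each $g\in G$ there exists a function $P_g$ of $n$ and a finite number of shifts of $\mathbf{u}_0$ with $$g\cdot\mathsf{L}=\mathsf{L}+(\mathrm{S}-\mathrm{id})P_g,$$ where $P_e=0$ for the identity $e\in G$. Introduce a new dependent variable $\zeta$ with shifts $\zeta_j=\mathrm{S}_j\zeta_0$ and set $$g\cdot\zeta_j=\mathrm{S}_j\big(\zeta_0-P_g\big),\qquad j\in\mathbb{Z}.$$ Then the group action on $(\mathrm{S}-\mathrm{id})\zeta$ so defined is a left action. Furthermore, the modified Lagrangian $$\overline{\mathsf{L}}=\mathsf{L}+(\mathrm{S}-\mathrm{id})\zeta_0$$ is invariant under all $g\in G$.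
   Context: The independent variable is $n\in\mathbb{Z}$; the dependent variables are $\mathbf{u}=(u^1,\dots,u^q)\in\mathbb{R}^q$, with $\mathbf{u}_j=\mathbf{u}(n+j)$. The shift operator is $\mathrm{S}:n\mapsto n+1$, $\mathrm{S}:\mathbf{u}_j\mapsto\mathbf{u}_{j+1}$, $\mathrm{S}_j=\mathrm{S}^j$, and $\mathrm{id}$ is the identity operator. The action of $G$ is prolonged diagonally to all shifts, $\mathbf{u}_j\mapsto g\cdot\mathbf{u}_j$, and $g\cdot F$ denotes the function obtained by replacing every variable in $F$ by its transformed version, e.g. $g\cdot\mathsf{L}=\mathsf{L}(n,g\cdot\mathbf{u}_0,\dots,g\cdot\mathbf{u}_J)$. A left action is one for which $(hg)\cdot z=h\cdot(g\cdot z)$ for all $g,h\in G$; the left action asserted here is that on the differences $(\mathrm{S}-\mathrm{id})\zeta_j=\zeta_{j+1}-\zeta_j$, jointly with the given action on the variables $\mathbf{u}_j$, so that $g$ maps $(\mathrm{S}-\mathrm{id})\zeta_j$ to $(\mathrm{S}-\mathrm{id})\mathrm{S}_j(\zeta_0-P_g)$. *)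

theory Defs
  imports "HOL-Analysis.Analysis" "HOL-Algebra.Group_Action"
begin

section \<open>Lie groups and their smooth actions\<close>

text \<open>
  Differentiability class C^k on an open subset of a finite-dimensional space, by recursion
  on directional derivatives: f is C^(k+1) iff it is differentiable and each directional
  derivative (in a fixed direction v) is C^k.
\<close>

primrec C_k_on :: "nat \<Rightarrow> 'a::real_normed_vector set \<Rightarrow> ('a \<Rightarrow> 'b::real_normed_vector) \<Rightarrow> bool" where
  "C_k_on 0 S f \<longleftrightarrow> continuous_on S f"
| "C_k_on (Suc k) S f \<longleftrightarrow>
     (\<forall>x\<in>S. f differentiable (at x)) \<and> (\<forall>v. C_k_on k S (\<lambda>x. frechet_derivative f (at x) v))"

definition smooth_on :: "'a::real_normed_vector set \<Rightarrow> ('a \<Rightarrow> 'b::real_normed_vector) \<Rightarrow> bool" where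
  "smooth_on S f \<longleftrightarrow> (\<forall>k. C_k_on k S f)"

text \<open>
  A chart is a pair of its domain and its coordinate map. The model space is any
  finite-dimensional normed space rather than a Euclidean space of the library, because the
  latter always has positive dimension, whereas Lie groups of dimension 0 are allowed.
\<close>

type_synonym ('g, 'm) chart = "'g set \<times> ('g \<Rightarrow> 'm)"

definition smooth_manifold :: "'g topology \<Rightarrow> ('g, 'm::real_normed_vector) chart set \<Rightarrow> bool" where
  "smooth_manifold X A \<longleftrightarrow>
     (\<exists>B :: 'm set. finite B \<and> span B = UNIV) \<and>
     Hausdorff_space X \<and> second_countable X \<and>
     (\<Union>(U, \<phi>)\<in>A. U) = topspace X \<and>
     (\<forall>(U, \<phi>)\<in>A. openin X U \<and> open (\<phi> ` U) \<and>
        homeomorphic_map (subtopology X U) (top_of_set (\<phi> ` U)) \<phi>) \<and>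
     (\<forall>(U, \<phi>)\<in>A. \<forall>(V, \<psi>)\<in>A. smooth_on (\<phi> ` (U \<inter> V)) (\<psi> \<circ> inv_into U \<phi>))"

definition smooth_map ::
  "'g topology \<Rightarrow> ('g, 'm::real_normed_vector) chart set \<Rightarrow>
   'h topology \<Rightarrow> ('h, 'n::real_normed_vector) chart set \<Rightarrow> ('g \<Rightarrow> 'h) \<Rightarrow> bool" where
  "smooth_map X A Y B f \<longleftrightarrow>
     continuous_map X Y f \<and>
     (\<forall>(U, \<phi>)\<in>A. \<forall>(V, \<psi>)\<in>B. smooth_on (\<phi> ` (U \<inter> f -` V)) (\<psi> \<circ> f \<circ> inv_into U \<phi>))"

definition prod_atlas ::
  "('g, 'm) chart set \<Rightarrow> ('h, 'n) chart set \<Rightarrow> ('g \<times> 'h, 'm \<times> 'n) chart set" where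
  "prod_atlas A B = {(U \<times> V, map_prod \<phi> \<psi>) | U \<phi> V \<psi>. (U, \<phi>) \<in> A \<and> (V, \<psi>) \<in> B}"

definition std_atlas :: "('m::real_normed_vector, 'm) chart set" where
  "std_atlas = {(UNIV, id)}"

definition lie_group ::
  "('g, 'r) monoid_scheme \<Rightarrow> 'g topology \<Rightarrow> ('g, 'm::real_normed_vector) chart set \<Rightarrow> bool" where
  "lie_group G X A \<longleftrightarrow>
     group G \<and> topspace X = carrier G \<and> smooth_manifold X A \<and>
     smooth_map (prod_topology X X) (prod_atlas A A) X A (\<lambda>(g, h). g \<otimes>\<^bsub>G\<^esub> h) \<and>
     smooth_map X A X A (\<lambda>g. inv\<^bsub>G\<^esub> g)"

text \<open>
  The library's group actions are left actions: the product of \<open>g\<close> and \<open>h\<close> acts as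
  \<open>act g \<circ> act h\<close>, and the identity acts as the identity map.
\<close>

definition lie_group_action ::
  "('g, 'r) monoid_scheme \<Rightarrow> 'g topology \<Rightarrow> ('g, 'm::real_normed_vector) chart set \<Rightarrow>
   ('g \<Rightarrow> 'v::real_normed_vector \<Rightarrow> 'v) \<Rightarrow> bool" where
  "lie_group_action G X A act \<longleftrightarrow>
     group_action G UNIV act \<and>
     smooth_map (prod_topology X euclidean) (prod_atlas A std_atlas) euclidean std_atlas
       (\<lambda>(g, x). act g x)"


section \<open>Difference functions\<close>

text \<open>
  A point \<open>(n, v)\<close> assigns a value to the independent variable \<open>n\<close> and, independently, to
  every shift \<open>v j\<close> of the dependent variables. Difference expressions are
  functions of such points; an identity between expressions is an identity of functions.
\<close>

type_synonym 'v point = "int \<times> (int \<Rightarrow> 'v)"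

definition shift_point :: "int \<Rightarrow> 'v point \<Rightarrow> 'v point" where
  "shift_point k = (\<lambda>(n, v). (n + k, \<lambda>j. v (j + k)))"

definition Shift :: "int \<Rightarrow> ('v point \<Rightarrow> 'a) \<Rightarrow> 'v point \<Rightarrow> 'a" where
  "Shift k F = (\<lambda>z. F (shift_point k z))"

text \<open>The forward difference \<open>(S - id) F\<close>.\<close>

definition Delta :: "('v point \<Rightarrow> real) \<Rightarrow> 'v point \<Rightarrow> real" where
  "Delta F = (\<lambda>z. Shift 1 F z - F z)"

definition depends_on_shifts :: "int set \<Rightarrow> ('v point \<Rightarrow> 'a) \<Rightarrow> bool" where
  "depends_on_shifts K F \<longleftrightarrow> (\<forall>n v w. (\<forall>j\<in>K. v j = w j) \<longrightarrow> F (n, v) = F (n, w))"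

definition prolong :: "('g \<Rightarrow> 'v \<Rightarrow> 'v) \<Rightarrow> 'g \<Rightarrow> 'v point \<Rightarrow> 'v point" where
  "prolong act g = (\<lambda>(n, v). (n, \<lambda>j. act g (v j)))"

text \<open>
  \<open>g \<cdot> F\<close> for a function \<open>F\<close>, where \<open>T g\<close> is the transformation of the points by \<open>g\<close>:
  each variable in \<open>F\<close> is replaced by its transformed version.
\<close>

definition transform :: "('g \<Rightarrow> 'v point \<Rightarrow> 'v point) \<Rightarrow> 'g \<Rightarrow> ('v point \<Rightarrow> 'a) \<Rightarrow> 'v point \<Rightarrow> 'a" where
  "transform T g F = (\<lambda>z. F (T g z))"


section \<open>The new dependent variable\<close>

text \<open>
  With the new variable \<open>\<zeta>\<close> adjoined, the dependent variables are pairs \<open>(u, \<zeta>)\<close>.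
  The map \<open>base\<close> forgets the second component, so \<open>F \<circ> base\<close> is a function \<open>F\<close> of
  \<open>n\<close> and the \<open>u\<close>'s regarded as a function of all variables.
\<close>

definition base :: "('v \<times> real) point \<Rightarrow> 'v point" where
  "base = (\<lambda>(n, y). (n, \<lambda>j. fst (y j)))"

definition zeta :: "int \<Rightarrow> ('v \<times> real) point \<Rightarrow> real" where
  "zeta j = Shift j (\<lambda>(n, y). snd (y 0))"

definition zeta_action ::
  "('g \<Rightarrow> 'v \<Rightarrow> 'v) \<Rightarrow> ('g \<Rightarrow> 'v point \<Rightarrow> real) \<Rightarrow> 'g \<Rightarrow> ('v \<times> real) point \<Rightarrow> ('v \<times> real) point" where
  "zeta_action act P g =
     (\<lambda>(n, y). (n, \<lambda>j. (act g (fst (y j)), Shift j (\<lambda>z. zeta 0 z - P g (base z)) (n, y))))"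

definition modified_Lagrangian :: "('v point \<Rightarrow> real) \<Rightarrow> ('v \<times> real) point \<Rightarrow> real" where
  "modified_Lagrangian L = (\<lambda>z. L (base z) + Delta (zeta 0) z)"

text \<open>
  The differences \<open>w\<^sub>j = \<zeta>\<^sub>j\<^sub>+\<^sub>1 - \<zeta>\<^sub>j\<close> are themselves used as coordinates, together
  with the \<open>u\<^sub>j\<close>: a point \<open>(n, y)\<close> of the difference space has \<open>y j = (u\<^sub>j, w\<^sub>j)\<close>.
  The transformation \<open>zeta_action\<close> descends to this space: \<open>g\<close> maps \<open>w\<^sub>j\<close> to
  \<open>(S - id) S\<^sub>j (\<zeta>\<^sub>0 - P\<^sub>g) = w\<^sub>j - (S - id) S\<^sub>j P\<^sub>g\<close>. The lemmas below show that
  \<open>difference_action\<close> is the unique map induced in this way.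
\<close>

definition differences :: "('v \<times> real) point \<Rightarrow> ('v \<times> real) point" where
  "differences = (\<lambda>(n, y). (n, \<lambda>j. (fst (y j), Delta (zeta j) (n, y))))"

definition difference_action ::
  "('g \<Rightarrow> 'v \<Rightarrow> 'v) \<Rightarrow> ('g \<Rightarrow> 'v point \<Rightarrow> real) \<Rightarrow> 'g \<Rightarrow> ('v \<times> real) point \<Rightarrow> ('v \<times> real) point" where
  "difference_action act P g =
     (\<lambda>(n, y). (n, \<lambda>j. (act g (fst (y j)),
                         snd (y j) - Delta (Shift j (P g)) (base (n, y)))))"

lemma difference_action_induced:
  "differences (zeta_action act P g z) = difference_action act P g (differences z)"
  by (cases z)
    (simp add: differences_def zeta_action_def difference_action_def Delta_def Shift_def
      shift_point_def zeta_def base_def algebra_simps)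

lemma surj_differences: "surj (differences :: ('v \<times> real) point \<Rightarrow> ('v \<times> real) point)"
proof (rule surjI)
  fix z :: "('v \<times> real) point"
  obtain n y where z: "z = (n, y)" by (cases z)
  define s where "s j = (\<Sum>i\<in>{0..<j}. snd (y i)) - (\<Sum>i\<in>{j..<0}. snd (y i))" for j :: int
  have step: "s (1 + j) - s j = snd (y j)" for j
  proof (cases "j \<ge> 0")
    case True
    then have "{0..<1 + j} = insert j {0..<j}" by auto
    with True show ?thesis by (simp add: s_def)
  next
    case False
    then have "{j..<0} = insert j {1 + j..<0}" by auto
    with False show ?thesis by (simp add: s_def)
  qed
  show "differences ((\<lambda>(n, y). (n, \<lambda>j. (fst (y j),
      (\<Sum>i\<in>{0..<j}. snd (y i)) - (\<Sum>i\<in>{j..<0}. snd (y i))))) z) = z"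
    using step
    by (auto simp: z differences_def Delta_def zeta_def Shift_def shift_point_def s_def
        add.commute fun_eq_iff prod_eq_iff)
qed

end

theory Submission
  imports Defs
begin

text \<open>
  Only the differences of the functions \<open>P\<^sub>g\<close> are determined by the Lagrangian, through
  \<open>(S - id) P\<^sub>g = g \<cdot> L - L\<close>. So \<open>g \<mapsto> (S - id) P\<^sub>g\<close> is a coboundary, and it satisfies the
  cocycle identity \<open>(S - id) P\<^sub>g\<^sub>h = h \<cdot> (S - id) P\<^sub>g + (S - id) P\<^sub>h\<close>, because the
  terms \<open>h \<cdot> L\<close> cancel (lemma \<open>Delta_cocycle\<close>). Translating a coordinate by minus a cocycle turns
  an action into an action (lemma \<open>difference_action_mult\<close>). The functions \<open>P\<^sub>g\<close> themselves
  satisfy the cocycle identity only up to elements of the kernel of \<open>S - id\<close>, and this is why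
  the left action is found on the differences of \<open>\<zeta>\<close> rather than on \<open>\<zeta>\<close>.

  The modified Lagrangian is invariant because \<open>g\<close> adds \<open>(S - id) P\<^sub>g\<close> to \<open>L\<close> and subtracts
  the same expression from \<open>(S - id) \<zeta>\<^sub>0\<close>.
\<close>

text \<open>
  On the whole type, extensionality is no restriction, and bijectivity of every map follows
  from the group laws because the image of an inverse is a two-sided inverse.
\<close>

lemma (in group) group_action_UNIV_I:
  assumes one: "\<phi> \<one> = id"
    and mult: "\<And>g h. g \<in> carrier G \<Longrightarrow> h \<in> carrier G \<Longrightarrow> \<phi> (g \<otimes> h) = \<phi> g \<circ> \<phi> h"
  shows "group_action G UNIV \<phi>"
proof -
  have Bij: "\<phi> g \<in> Bij UNIV" if g: "g \<in> carrier G" for g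
  proof -
    have "\<phi> g \<circ> \<phi> (inv g) = id" "\<phi> (inv g) \<circ> \<phi> g = id"
      using g one by (simp_all flip: mult)
    then have "bij (\<phi> g)"
      by (metis o_bij)
    then show ?thesis
      by (simp add: Bij_def)
  qed
  then have "\<phi> \<in> hom G (BijGroup UNIV)"
    by (auto simp: hom_def BijGroup_def mult compose_def fun_eq_iff)
  then show ?thesis
    unfolding group_action_def group_hom_def group_hom_axioms_def
    using group_axioms group_BijGroup by blast
qed

lemma group_action_UNIV_mult:
  assumes "group_action G UNIV \<phi>" "g \<in> carrier G" "h \<in> carrier G"
  shows "\<phi> (g \<otimes>\<^bsub>G\<^esub> h) x = \<phi> g (\<phi> h x)"
  using group_action.composition_rule[OF assms(1) _ assms(2,3)] by simp

lemma group_action_UNIV_one: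
  assumes "group_action G UNIV \<phi>"
  shows "\<phi> \<one>\<^bsub>G\<^esub> x = x"
  using group_action.id_eq_one[OF assms] by (metis UNIV_I restrict_apply')

lemma prolong_mult:
  assumes "group_action G UNIV act" "g \<in> carrier G" "h \<in> carrier G"
  shows "prolong act (g \<otimes>\<^bsub>G\<^esub> h) z = prolong act g (prolong act h z)"
  by (simp add: prolong_def group_action_UNIV_mult[OF assms] split: prod.split)

lemma Delta_Shift: "Delta (Shift j F) z = Delta F (shift_point j z)"
  by (simp add: Delta_def Shift_def shift_point_def algebra_simps split: prod.split)

lemma shift_point_prolong: "shift_point j (prolong act g z) = prolong act g (shift_point j z)"
  by (simp add: shift_point_def prolong_def split: prod.split)

text \<open>
  The identity is a telescoping sum along the path from \<open>z\<close> via \<open>h \<cdot> z\<close> to \<open>g \<cdot> (h \<cdot> z)\<close>,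
  each summand being the change of \<open>L\<close>. The hypothesis on \<open>L\<close> holds at every point, so \<open>z\<close> may
  be a shifted point: this gives the identity for the differences at every index \<open>j\<close>.
\<close>

lemma Delta_cocycle:
  assumes act: "group_action G UNIV act"
    and L: "\<And>g z. g \<in> carrier G \<Longrightarrow> L (prolong act g z) = L z + Delta (P g) z"
    and g: "g \<in> carrier G" and h: "h \<in> carrier G"
  shows "Delta (P (g \<otimes>\<^bsub>G\<^esub> h)) z = Delta (P g) (prolong act h z) + Delta (P h) z"
proof -
  interpret group G
    using act by (rule group_action.group_hom[THEN group_hom.axioms(1)])
  have "L z + Delta (P (g \<otimes>\<^bsub>G\<^esub> h)) z = L (prolong act g (prolong act h z))"
    using L[of "g \<otimes>\<^bsub>G\<^esub> h"] g h by (simp add: prolong_mult[OF act])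
  also have "\<dots> = L z + Delta (P h) z + Delta (P g) (prolong act h z)"
    using L g h by simp
  finally show ?thesis
    by simp
qed

text \<open>
  Shifts commute with the prolonged action, so the translation of the coordinate with index
  \<open>j\<close> is the cocycle evaluated at the \<open>j\<close>-th shift of the point.
\<close>

lemma difference_action_mult:
  fixes act :: "'g \<Rightarrow> 'v \<Rightarrow> 'v"
  assumes act: "group_action G UNIV act"
    and g: "g \<in> carrier G" and h: "h \<in> carrier G"
    and cocycle: "\<And>z. Delta (P (g \<otimes>\<^bsub>G\<^esub> h)) z = Delta (P g) (prolong act h z) + Delta (P h) z"
  shows "difference_action act P (g \<otimes>\<^bsub>G\<^esub> h) = difference_action act P g \<circ> difference_action act P h"
proof
  fix z :: "('v \<times> real) point"
  obtain n y where z: "z = (n, y)"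
    by (cases z)
  have "base (difference_action act P h z) = prolong act h (base z)"
    by (simp add: z base_def difference_action_def prolong_def)
  then show "difference_action act P (g \<otimes>\<^bsub>G\<^esub> h) z =
      (difference_action act P g \<circ> difference_action act P h) z"
    by (simp add: z difference_action_def Delta_Shift cocycle shift_point_prolong
        group_action_UNIV_mult[OF act g h] algebra_simps)
qed

lemma base_zeta_action: "base (zeta_action act P g z) = prolong act g (base z)"
  by (simp add: base_def zeta_action_def prolong_def split: prod.split)

lemma Delta_zeta_action:
  "Delta (zeta 0) (zeta_action act P g z) = Delta (zeta 0) z - Delta (P g) (base z)"
  by (simp add: Delta_def zeta_def Shift_def shift_point_def zeta_action_def base_def
      split: prod.split)

theorem lemma9p1:
  fixes G :: "('g, 'r) monoid_scheme"
    and X :: "'g topology"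
    and A :: "('g, 'm::real_normed_vector) chart set"
    and act :: "'g \<Rightarrow> real ^ 'q \<Rightarrow> real ^ 'q"
    and L :: "(real ^ 'q) point \<Rightarrow> real"
    and J :: nat
    and P :: "'g \<Rightarrow> (real ^ 'q) point \<Rightarrow> real"
  assumes "lie_group G X A"
    and "lie_group_action G X A act"
    and "depends_on_shifts {0..int J} L"
    and "\<And>g. g \<in> carrier G \<Longrightarrow> \<exists>K. finite K \<and> depends_on_shifts K (P g)"
    and "\<And>g. g \<in> carrier G \<Longrightarrow> transform (prolong act) g L = (\<lambda>z. L z + Delta (P g) z)"
    and "P \<one>\<^bsub>G\<^esub> = (\<lambda>z. 0)"
  shows "group_action G UNIV (difference_action act P) \<and>
    (\<forall>g\<in>carrier G.
       transform (zeta_action act P) g (modified_Lagrangian L) = modified_Lagrangian L)"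
proof (intro conjI ballI)
  have act: "group_action G UNIV act"
    using assms(2) by (simp add: lie_group_action_def)
  interpret group G
    using assms(1) by (simp add: lie_group_def)
  have L: "L (prolong act g z) = L z + Delta (P g) z" if "g \<in> carrier G" for g z
    using fun_cong[OF assms(5)[OF that], of z] by (simp add: transform_def)
  show "group_action G UNIV (difference_action act P)"
  proof (rule group_action_UNIV_I)
    show "difference_action act P \<one>\<^bsub>G\<^esub> = id"
      by (auto simp: difference_action_def assms(6) Delta_def Shift_def fun_eq_iff
          group_action_UNIV_one[OF act])
    show "difference_action act P (g \<otimes>\<^bsub>G\<^esub> h) =
        difference_action act P g \<circ> difference_action act P h"
      if "g \<in> carrier G" "h \<in> carrier G" for g h
      using act that by (rule difference_action_mult) (rule Delta_cocycle[where L = L, OF act L that])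
  qed
  show "transform (zeta_action act P) g (modified_Lagrangian L) = modified_Lagrangian L"
    if "g \<in> carrier G" for g
    by (simp add: transform_def modified_Lagrangian_def base_zeta_action Delta_zeta_action
        L[OF that])
qed

end
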